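(* Let $n\ge1$, let $h:\mathbb{R}^n\to\mathbb{R}$ be a positively homogeneous function of degree $p\in\mathbb{R}$, let $0\neq d\in\mathbb{R}$, and define $f_h:C_d\to\mathbb{R}$ by $$f_h(g):=\int_{\{\mathbf{x}:g(\mathbf{x})\le 1\}}h(\mathbf{x})\,d\mathbf{x},\qquad g\in C_d.$$ Then $f_h$ is positively homogeneous of degree $-(n+p)/d$, i.e. $f_h(\lambda g)=\lambda^{-(n+p)/d}f_h(g)$ for all $\lambda>0$, $g\in C_d$, and $f_h$ is convex whenever $h$ is nonnegative (and strictly convex if $h>0$ on $\mathbb{R}^n\setminus\{0\}$). In addition, if $d\in\mathbb{N}$ and $h$ is continuous with $\int_{\mathbb{R}^n}|h|\exp(-g)\,d\mathbf{x}<\infty$, then: (a) $f_h$ (as a function of the coefficients $(g_\alpha)_{|\alpha|=d}$ of $g$) is twice differentiable on $\mathrm{int}(\mathbf{P}[\mathbf{x}]_d)$, and for all $\alpha,\beta\in\mathbb{N}^n$ with $|\alpha|=|\beta|=d$: $$\frac{\partial f_h(g)}{\partial g_\alpha}=\frac{-1}{\Gamma(1+(n+p)/d)}\int_{\mathbb{R}^n}\mathbf{x}^\alpha h(\mathbf{x})\exp(-g(\mathbf{x}))\,d\mathbf{x}=\frac{-\Gamma(2+(n+p)/d)}{\Gamma(1+(n+p)/d)}\int_{\{\mathbf{x}:g(\mathbf{x})\le 1\}}\mathbf{x}^\alpha h(\mathbf{x})\,d\mathbf{x},$$ $$\frac{\partial^2 f_h(g)}{\partial g_\alpha\partial g_\beta}=\frac{1}{\Gamma(1+(n+p)/d)}\int_{\mathbb{R}^n}\mathbf{x}^{\alpha+\beta}h(\mathbf{x})\exp(-g(\mathbf{x}))\,d\mathbf{x}.$$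 (b) If $h$ is non trivial (not identically zero) and nonnegative, then $f_h$ is strictly convex on $\mathrm{int}(\mathbf{P}[\mathbf{x}]_d)$, and its Hessian $\nabla^2 f_h(g)$ is the matrix of $2d$-moments $\left(\int\mathbf{x}^{\alpha+\beta}d\nu\right)_{|\alpha|=|\beta|=d}$ of the measure $$\nu(B)=\frac{1}{\Gamma(1+(n+p)/d)}\int_B h\exp(-g)\,d\mathbf{x},\qquad B\subset\mathbb{R}^n\text{ Borel}.$$
   Context: A continuous function $f:\mathbb{R}^n\to\mathbb{R}$ is positively homogeneous (a PHF) of degree $k\in\mathbb{R}$ if $f(\lambda\mathbf{x})=\lambda^k f(\mathbf{x})$ for all $\lambda>0$ and all $\mathbf{x}\in\mathbb{R}^n$. $C_d$ is the convex cone of PHFs $g:\mathbb{R}^n\to\mathbb{R}$ of degree $d$ whose sublevel set $\{\mathbf{x}:g(\mathbf{x})\le1\}$ is bounded. For $d\in\mathbb{N}$, $\mathbf{P}[\mathbf{x}]_d\subset C_d$ is the convex cone of homogeneous polynomials $g(\mathbf{x})=\sum_{|\alpha|=d}g_\alpha\mathbf{x}^\alpha$ of degree $d$ with compact sublevel set $\{\mathbf{x}:g(\mathbf{x})\le 1\}$; it is identified with a subset of $\mathbb{R}^{\ell(d)}$, $\ell(d)=\binom{n+d-1}{d}$, via coefficient vectors, and $\mathrm{int}$ denotes the interior in $\mathbb{R}^{\ell(d)}$. Here $|\alpha|=\sum_i\alpha_i$. $\Gamma$ is the standard Gamma function. *)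

theory Defs
  imports "HOL-Analysis.Analysis"
begin

definition phf :: "real \<Rightarrow> (real^'n \<Rightarrow> real) \<Rightarrow> bool" where
  "phf k f \<longleftrightarrow> continuous_on UNIV f \<and> (\<forall>c>0. \<forall>x. f (c *\<^sub>R x) = c powr k * f x)"

definition sublevel :: "(real^'n \<Rightarrow> real) \<Rightarrow> (real^'n) set" where
  "sublevel g = {x. g x \<le> 1}"

definition phf_cone :: "real \<Rightarrow> (real^'n \<Rightarrow> real) set" where
  "phf_cone d = {g. phf d g \<and> bounded (sublevel g)}"

definition sublevel_integral :: "(real^'n \<Rightarrow> real) \<Rightarrow> (real^'n \<Rightarrow> real) \<Rightarrow> real" where
  "sublevel_integral h g = (LINT x:sublevel g|lborel. h x)"


text \<open>The function type is not an instance of \<^class>\<open>real_vector\<close>, so for functionals on a set of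
  functions the vector operations are written out pointwise. As in \<^const>\<open>convex_on\<close>, the domain
  is required to be closed under the operations involved.\<close>

definition homogeneous_functional_on ::
    "('a \<Rightarrow> real) set \<Rightarrow> real \<Rightarrow> (('a \<Rightarrow> real) \<Rightarrow> real) \<Rightarrow> bool" where
  "homogeneous_functional_on S k F \<longleftrightarrow>
     (\<forall>g\<in>S. \<forall>c>0. (\<lambda>x. c * g x) \<in> S \<and> F (\<lambda>x. c * g x) = c powr k * F g)"

definition convex_function_set :: "('a \<Rightarrow> real) set \<Rightarrow> bool" where
  "convex_function_set S \<longleftrightarrow>
     (\<forall>g1\<in>S. \<forall>g2\<in>S. \<forall>u\<ge>0. \<forall>v\<ge>0. u + v = 1 \<longrightarrow> (\<lambda>x. u * g1 x + v * g2 x) \<in> S)"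

definition convex_functional_on :: "('a \<Rightarrow> real) set \<Rightarrow> (('a \<Rightarrow> real) \<Rightarrow> real) \<Rightarrow> bool" where
  "convex_functional_on S F \<longleftrightarrow> convex_function_set S \<and>
     (\<forall>g1\<in>S. \<forall>g2\<in>S. \<forall>u\<ge>0. \<forall>v\<ge>0. u + v = 1 \<longrightarrow>
        F (\<lambda>x. u * g1 x + v * g2 x) \<le> u * F g1 + v * F g2)"

definition strictly_convex_functional_on ::
    "('a \<Rightarrow> real) set \<Rightarrow> (('a \<Rightarrow> real) \<Rightarrow> real) \<Rightarrow> bool" where
  "strictly_convex_functional_on S F \<longleftrightarrow> convex_function_set S \<and>
     (\<forall>g1\<in>S. \<forall>g2\<in>S. \<forall>u>0. \<forall>v>0. g1 \<noteq> g2 \<and> u + v = 1 \<longrightarrow>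
        F (\<lambda>x. u * g1 x + v * g2 x) < u * F g1 + v * F g2)"

definition strictly_convex_on :: "'a::real_vector set \<Rightarrow> ('a \<Rightarrow> real) \<Rightarrow> bool" where
  "strictly_convex_on S f \<longleftrightarrow> convex S \<and>
     (\<forall>x\<in>S. \<forall>y\<in>S. \<forall>u>0. \<forall>v>0. x \<noteq> y \<and> u + v = 1 \<longrightarrow>
        f (u *\<^sub>R x + v *\<^sub>R y) < u * f x + v * f y)"


text \<open>Multi-indices are elements of \<open>nat^'n\<close>, with pointwise addition.\<close>

definition multi_degree :: "nat^'n \<Rightarrow> nat" where
  "multi_degree \<alpha> = (\<Sum>i\<in>UNIV. \<alpha> $ i)"

definition mono_eval :: "nat^'n \<Rightarrow> real^'n \<Rightarrow> real" where
  "mono_eval \<alpha> x = (\<Prod>i\<in>UNIV. (x $ i) ^ (\<alpha> $ i))"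

text \<open>The coefficient space of dimension \<open>(n+k-1) choose k\<close> is \<open>real^'m\<close>, where the finite type
  \<open>'m\<close> indexes the multi-indices of degree \<open>k\<close> through a bijection \<open>mon\<close>; the coordinate \<open>i\<close> of a
  vector is the coefficient of the monomial with exponent \<open>mon i\<close>.\<close>

definition enumerates_degree :: "nat \<Rightarrow> ('m::finite \<Rightarrow> nat^'n) \<Rightarrow> bool" where
  "enumerates_degree k mon \<longleftrightarrow> bij_betw mon UNIV {\<alpha>. multi_degree \<alpha> = k}"

definition form :: "('m::finite \<Rightarrow> nat^'n) \<Rightarrow> real^'m \<Rightarrow> real^'n \<Rightarrow> real" where
  "form mon c x = (\<Sum>i\<in>UNIV. c $ i * mono_eval (mon i) x)"

definition form_cone :: "('m::finite \<Rightarrow> nat^'n) \<Rightarrow> (real^'m) set" where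
  "form_cone mon = {c. compact (sublevel (form mon c))}"


definition partial_deriv :: "'m::finite \<Rightarrow> (real^'m \<Rightarrow> real) \<Rightarrow> real^'m \<Rightarrow> real" where
  "partial_deriv i F c = deriv (\<lambda>t. F (c + t *\<^sub>R axis i 1)) 0"

definition gradient :: "(real^'m::finite \<Rightarrow> real) \<Rightarrow> real^'m \<Rightarrow> real^'m" where
  "gradient F c = (\<chi> i. partial_deriv i F c)"

definition hessian :: "(real^'m::finite \<Rightarrow> real) \<Rightarrow> real^'m \<Rightarrow> real^'m^'m" where
  "hessian F c = (\<chi> i j. partial_deriv i (partial_deriv j F) c)"

text \<open>Frechet differentiability of \<open>F\<close> and of its derivative; meant for open sets. Where it holds,
  the partial derivatives of order one and two above are genuine.\<close>

definition twice_differentiable_on_open :: "(real^'m::finite \<Rightarrow> real) \<Rightarrow> (real^'m) set \<Rightarrow> bool" where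
  "twice_differentiable_on_open F S \<longleftrightarrow>
     (\<forall>c\<in>S. F differentiable (at c) \<and> gradient F differentiable (at c))"

definition exp_measure ::
    "(real^'n \<Rightarrow> real) \<Rightarrow> real \<Rightarrow> real \<Rightarrow> (real^'n \<Rightarrow> real) \<Rightarrow> (real^'n) measure" where
  "exp_measure h p d g =
     density lborel (\<lambda>x. ennreal (1 / Gamma (1 + (real CARD('n) + p) / d) * (h x * exp (- g x))))"

end

theory Submission
  imports Defs
begin

text \<open>Writing \<open>exp (- g x)\<close> as the integral of \<open>exp (- t)\<close> over \<open>t \<ge> g x\<close> and exchanging the order
  of integration turns \<open>\<integral> \<phi> exp (- g)\<close> into the integral over \<open>t > 0\<close> of \<open>exp (- t)\<close> times the
  integral of \<open>\<phi>\<close> over \<open>{g \<le> t}\<close>. For \<open>\<phi>\<close> of degree \<open>r\<close> and \<open>g\<close> of degree \<open>d\<close> the latter scales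
  like \<open>t\<close> to the power \<open>(n + r) / d\<close>, so that
  \<open>\<integral> \<phi> exp (- g) = \<Gamma> (1 + (n + r) / d) \<integral>\<^bsub>{g \<le> 1}\<^esub> \<phi>\<close>. Convexity is then inherited from that of \<open>exp\<close>,
  and the derivatives in the coefficients of \<open>g\<close> are obtained under the integral sign, where the
  Taylor remainder is quadratic in the increment because \<open>g\<close> dominates a positive multiple of
  \<open>norm x ^ d\<close>. Strict convexity in the coefficients holds because a nonzero form cannot vanish on
  the nonempty open set \<open>{h > 0}\<close>.\<close>

section \<open>Positively homogeneous functions\<close>

lemma phf_continuous_on: "phf k f \<Longrightarrow> continuous_on S f"
  unfolding phf_def using continuous_on_subset by blast

lemma phf_scale: "phf k f \<Longrightarrow> c > 0 \<Longrightarrow> f (c *\<^sub>R x) = c powr k * f x"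
  unfolding phf_def by blast

lemma phf_borel_measurable [measurable_dest]:
  fixes f :: "real^'n \<Rightarrow> real"
  shows "phf k f \<Longrightarrow> f \<in> borel_measurable borel"
  by (intro borel_measurable_continuous_onI phf_continuous_on)

text \<open>Continuity at the origin leaves only the zero function in negative degree. Hence
  \<open>phf_cone d\<close> is empty for \<open>d < 0\<close>.\<close>

lemma phf_degree_nonneg:
  fixes f :: "real^'n \<Rightarrow> real"
  assumes f: "phf k f" and "f x \<noteq> 0"
  shows "0 \<le> k"
proof (rule ccontr)
  assume "\<not> 0 \<le> k"
  then have k: "k < 0" by simp
  have "isCont f 0"
    using phf_continuous_on[OF f, of UNIV] by (simp add: continuous_on_eq_continuous_at)
  moreover have "((\<lambda>c::real. c *\<^sub>R x) \<longlongrightarrow> 0) (at_right 0)"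
    by (auto intro!: tendsto_eq_intros)
  ultimately have 1: "((\<lambda>c::real. f (c *\<^sub>R x)) \<longlongrightarrow> f 0) (at_right 0)"
    by (rule isCont_tendsto_compose)
  \<comment> \<open>The exponent \<open>- k\<close> is positive, so this factor tends to 0 and so
    does its product with the convergent values on the ray. By homogeneity that product is
    constantly \<open>f x\<close>, which must then be 0.\<close>
  have "((\<lambda>c::real. c powr (-k)) \<longlongrightarrow> 0 powr (-k)) (at_right 0)"
    using k by (intro tendsto_powr') (auto simp: eventually_at_right_less intro!: eventually_at_rightI[of 0 1])
  then have "((\<lambda>c::real. c powr (-k) * f (c *\<^sub>R x)) \<longlongrightarrow> 0 powr (-k) * f 0) (at_right 0)"
    by (intro tendsto_mult 1)
  moreover have "\<forall>\<^sub>F c in at_right (0::real). c powr (-k) * f (c *\<^sub>R x) = f x"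
    by (rule eventually_at_rightI[of 0 1]) (auto simp: phf_scale[OF f] powr_minus)
  ultimately have "((\<lambda>c::real. f x) \<longlongrightarrow> 0) (at_right 0)"
    by (simp add: tendsto_cong)
  then show False
    using \<open>f x \<noteq> 0\<close> by (simp add: tendsto_const_iff)
qed

lemma phf_at_zero:
  assumes "phf k f" "k \<noteq> 0"
  shows "f 0 = 0"
proof -
  have "f 0 = 2 powr k * f 0"
    using phf_scale[OF assms(1), of 2 0] by simp
  moreover have "2 powr k \<noteq> (1::real)"
    using assms(2) by (simp add: powr_eq_one_iff_gen)
  ultimately show ?thesis by simp
qed

lemma phf_mult: "phf j f \<Longrightarrow> phf k g \<Longrightarrow> phf (j + k) (\<lambda>x. f x * g x)"
  unfolding phf_def by (auto intro!: continuous_intros simp: powr_add)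

lemma phf_add: "phf k f \<Longrightarrow> phf k g \<Longrightarrow> phf k (\<lambda>x. f x + g x)"
  unfolding phf_def by (auto intro!: continuous_intros simp: algebra_simps)

lemma phf_cmult: "phf k f \<Longrightarrow> phf k (\<lambda>x. a * f x)"
  unfolding phf_def by (auto intro!: continuous_intros)

lemma phf_max_zero: "phf k f \<Longrightarrow> phf k (\<lambda>x. max (f x) 0)"
  unfolding phf_def by (auto intro!: continuous_intros simp: max_mult_distrib_left)

lemma phf_abs: "phf k f \<Longrightarrow> phf k (\<lambda>x. \<bar>f x\<bar>)"
  unfolding phf_def by (auto intro!: continuous_intros simp: abs_mult)

lemma phf_norm_powr:
  assumes "k > 0"
  shows "phf k (\<lambda>x::real^'n. norm x powr k)"
  unfolding phf_def using assms
  using continuous_on_powr'[OF continuous_on_norm_id continuous_on_const, of UNIV k]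
  by (auto simp: powr_mult)

text \<open>A value \<open>g x \<le> 0\<close> at some \<open>x \<noteq> 0\<close> stays nonpositive
  along the whole open ray through \<open>x\<close>, which would put an unbounded ray into the
  sublevel set.\<close>

lemma phf_cone_pos:
  fixes g :: "real^'n \<Rightarrow> real"
  assumes g: "g \<in> phf_cone d" and "x \<noteq> 0"
  shows "g x > 0"
proof (rule ccontr)
  assume "\<not> g x > 0"
  then have le: "g x \<le> 0" by simp
  have phf: "phf d g" and bd: "bounded (sublevel g)"
    using g by (auto simp: phf_cone_def)
  obtain B where B: "\<And>y. y \<in> sublevel g \<Longrightarrow> norm y \<le> B"
    using bd by (auto simp: bounded_iff)
  \<comment> \<open>Chosen so that the scaled point has norm \<open>\<bar>B\<bar> + 1\<close>,
    beyond the bound \<open>B\<close>.\<close>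
  define c where "c = (\<bar>B\<bar> + 1) / norm x"
  have c: "c > 0" using \<open>x \<noteq> 0\<close> by (simp add: c_def add_nonneg_pos)
  have "g (c *\<^sub>R x) \<le> 0"
    using le c by (simp add: phf_scale[OF phf] mult_nonneg_nonpos)
  then have "norm (c *\<^sub>R x) \<le> B"
    by (intro B) (simp add: sublevel_def)
  then show False
    using \<open>x \<noteq> 0\<close> c by (simp add: c_def)
qed

text \<open>The space has at least one coordinate, so there is a nonzero vector; \<open>g\<close> is
  positive there, and a nonzero value excludes negative degree.\<close>

lemma phf_cone_degree_pos:
  fixes g :: "real^'n \<Rightarrow> real"
  assumes "g \<in> phf_cone d" "d \<noteq> 0"
  shows "d > 0"
proof -
  have "g (axis undefined 1) \<noteq> 0"
    using phf_cone_pos[OF assms(1), of "axis undefined 1"] by (simp add: axis_eq_0_iff)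
  then show ?thesis
    using phf_degree_nonneg assms by (fastforce simp: phf_cone_def)
qed

lemma phf_cone_nonneg:
  fixes g :: "real^'n \<Rightarrow> real"
  assumes "g \<in> phf_cone d" "d \<noteq> 0"
  shows "g x \<ge> 0"
  using assms phf_cone_pos[OF assms(1)] phf_at_zero[of d g]
  by (cases "x = 0") (auto simp: phf_cone_def less_imp_le)

lemma ex_norm_one: "\<exists>x::real^'n. norm x = 1"
  by (rule exI[of _ "axis undefined 1"]) simp

lemma phf_normalize:
  fixes f :: "real^'n \<Rightarrow> real"
  assumes "phf k f" "x \<noteq> 0"
  shows "f x = norm x powr k * f (x /\<^sub>R norm x)"
  using phf_scale[OF assms(1), of "norm x" "x /\<^sub>R norm x"] assms(2) by simp

text \<open>The constant is the minimum of \<open>g\<close> on the compact unit sphere, extended to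
  all vectors by homogeneity. At the origin both sides are 0.\<close>

lemma phf_pos_lower_bound:
  fixes g :: "real^'n \<Rightarrow> real"
  assumes g: "phf d g" "d \<noteq> 0" and pos: "\<And>x. x \<noteq> 0 \<Longrightarrow> g x > 0"
  shows "\<exists>m>0. \<forall>x. m * norm x powr d \<le> g x"
proof -
  have "\<exists>u\<in>sphere 0 1. \<forall>y\<in>sphere (0::real^'n) 1. g u \<le> g y"
    using ex_norm_one
    by (intro continuous_attains_inf phf_continuous_on[OF g(1)]) auto
  then obtain u where u: "norm u = 1" "\<And>y. norm y = 1 \<Longrightarrow> g u \<le> g y"
    by auto
  have "g u * norm x powr d \<le> g x" for x
  proof (cases "x = 0")
    case False
    then show ?thesis
      using u(2)[of "x /\<^sub>R norm x"]
      by (subst phf_normalize[OF g(1) False]) (simp add: mult.commute mult_left_mono)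
  qed (simp add: phf_at_zero[OF g])
  moreover have "g u > 0" using u(1) by (intro pos) auto
  ultimately show ?thesis by blast
qed

lemma phf_upper_bound:
  fixes f :: "real^'n \<Rightarrow> real"
  assumes f: "phf k f" "k \<noteq> 0"
  shows "\<exists>K\<ge>0. \<forall>x. \<bar>f x\<bar> \<le> K * norm x powr k"
proof -
  have "\<exists>u\<in>sphere 0 1. \<forall>y\<in>sphere (0::real^'n) 1. \<bar>f y\<bar> \<le> \<bar>f u\<bar>"
    using ex_norm_one
    by (intro continuous_attains_sup phf_continuous_on[OF phf_abs[OF f(1)]]) auto
  then obtain u where u: "norm u = 1" "\<And>y. norm y = 1 \<Longrightarrow> \<bar>f y\<bar> \<le> \<bar>f u\<bar>"
    by auto
  have "\<bar>f x\<bar> \<le> \<bar>f u\<bar> * norm x powr k" for x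
  proof (cases "x = 0")
    case False
    then show ?thesis
      using u(2)[of "x /\<^sub>R norm x"]
      by (subst phf_normalize[OF f(1) False]) (simp add: abs_mult mult.commute mult_left_mono)
  qed (simp add: phf_at_zero[OF f])
  then show ?thesis by (intro exI[of _ "\<bar>f u\<bar>"]) auto
qed

text \<open>Converse to \<open>phf_cone_pos\<close> in positive degree: the lower bound by a
  multiple of \<open>norm x powr d\<close> confines the sublevel set. Membership in the cone thus
  becomes positivity off the origin, which scaling and convex combinations visibly preserve.\<close>

lemma phf_coneI:
  fixes g :: "real^'n \<Rightarrow> real"
  assumes g: "phf d g" "d > 0" and pos: "\<And>x. x \<noteq> 0 \<Longrightarrow> g x > 0"
  shows "g \<in> phf_cone d"
proof -
  obtain m where m: "m > 0" "\<And>x. m * norm x powr d \<le> g x"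
    using phf_pos_lower_bound[OF g(1) _ pos] g(2) by auto
  have "norm x \<le> (1 / m) powr (1 / d)" if "x \<in> sublevel g" for x
  proof -
    have "m * norm x powr d \<le> 1"
      using m(2)[of x] that by (simp add: sublevel_def)
    then have "norm x powr d \<le> 1 / m"
      using m(1) by (simp add: field_simps)
    then have "(norm x powr d) powr (1 / d) \<le> (1 / m) powr (1 / d)"
      using g(2) by (intro powr_mono2) auto
    then show ?thesis using g(2) by (simp add: powr_powr)
  qed
  then have "bounded (sublevel g)" by (auto simp: bounded_iff)
  then show ?thesis using g(1) by (simp add: phf_cone_def)
qed

lemma phf_cone_scale:
  fixes g :: "real^'n \<Rightarrow> real"
  assumes "g \<in> phf_cone d" "d \<noteq> 0" "c > 0"
  shows "(\<lambda>x. c * g x) \<in> phf_cone d"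
  using assms phf_cone_pos[OF assms(1)] phf_cone_degree_pos[OF assms(1,2)]
  by (intro phf_coneI phf_cmult) (auto simp: phf_cone_def)

lemma convex_function_set_phf_cone:
  assumes "d \<noteq> 0"
  shows "convex_function_set (phf_cone d :: (real^'n \<Rightarrow> real) set)"
  unfolding convex_function_set_def
proof (intro ballI allI impI)
  fix g1 g2 :: "real^'n \<Rightarrow> real" and u v :: real
  assume g: "g1 \<in> phf_cone d" "g2 \<in> phf_cone d" and uv: "0 \<le> u" "0 \<le> v" "u + v = 1"
  show "(\<lambda>x. u * g1 x + v * g2 x) \<in> phf_cone d"
  proof (intro phf_coneI phf_add phf_cmult)
    show "0 < u * g1 x + v * g2 x" if "x \<noteq> 0" for x
      using phf_cone_pos[OF g(1) that] phf_cone_pos[OF g(2) that] uv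
      by (cases "u = 0") (auto intro!: add_pos_nonneg mult_nonneg_nonneg)
  qed (use g phf_cone_degree_pos[OF g(1) assms] in \<open>auto simp: phf_cone_def\<close>)
qed

lemma compact_sublevel:
  fixes g :: "real^'n \<Rightarrow> real"
  assumes "g \<in> phf_cone d"
  shows "compact (sublevel g)"
proof -
  have "closed (sublevel g)"
    unfolding sublevel_def using assms
    by (intro closed_Collect_le) (auto simp: phf_cone_def phf_def)
  then show ?thesis
    using assms by (auto simp: phf_cone_def compact_eq_bounded_closed)
qed

lemma set_integrable_sublevel:
  fixes g h :: "real^'n \<Rightarrow> real"
  assumes "g \<in> phf_cone d" "continuous_on UNIV h"
  shows "set_integrable lborel (sublevel g) h"
  unfolding set_integrable_def
  by (intro borel_integrable_compact compact_sublevel[OF assms(1)]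
      continuous_on_subset[OF assms(2)]) auto

section \<open>Sublevel sets and the Laplace transform\<close>

lemma lborel_integral_scaleR:
  fixes f :: "'a::euclidean_space \<Rightarrow> real"
  assumes "f \<in> borel_measurable borel" and "c \<noteq> 0"
  shows "(LINT x|lborel. f x) = \<bar>c\<bar> ^ DIM('a) * (LINT x|lborel. f (c *\<^sub>R x))"
proof -
  have "(LINT x|lborel. f x) =
    (LINT x|density (distr lborel borel (\<lambda>x::'a. 0 + c *\<^sub>R x)) (\<lambda>_. ennreal (\<bar>c\<bar> ^ DIM('a))). f x)"
    using lborel_affine[where c = c and t = "0::'a"] assms(2) by simp
  also have "\<dots> = \<bar>c\<bar> ^ DIM('a) * (LINT x|lborel. f (c *\<^sub>R x))"
    using assms(1) by (simp add: integral_density integral_distr)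
  finally show ?thesis .
qed

lemma sublevel_integral_scale:
  fixes g h :: "real^'n \<Rightarrow> real"
  assumes h: "phf r h" and g: "g \<in> phf_cone d" "d \<noteq> 0" and c: "c > 0"
  shows "sublevel_integral h (\<lambda>x. c * g x) =
    c powr (- (real CARD('n) + r) / d) * sublevel_integral h g"
proof -
  note [measurable] = phf_borel_measurable[OF h]
  have phf: "phf d g" using g by (simp add: phf_cone_def)
  note [measurable] = phf_borel_measurable[OF phf]
  \<comment> \<open>The solution of \<open>c * s powr d = 1\<close>: dilation by \<open>s\<close>
    maps the sublevel set of \<open>g\<close> onto that of \<open>c * g\<close>.\<close>
  define s where "s = c powr (- 1 / d)"
  have s: "s > 0" using c by (simp add: s_def)
  have sd: "c * s powr d = 1"
    using c g(2) unfolding s_def powr_powr by (simp add: powr_minus_divide)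
  have [measurable]: "sublevel (\<lambda>x. c * g x) \<in> sets borel" "sublevel g \<in> sets borel"
    unfolding sublevel_def by measurable
  have "sublevel_integral h (\<lambda>x. c * g x) =
    \<bar>s\<bar> ^ DIM(real^'n) *
      (LINT x|lborel. indicator (sublevel (\<lambda>x. c * g x)) (s *\<^sub>R x) *\<^sub>R h (s *\<^sub>R x))"
    unfolding sublevel_integral_def set_lebesgue_integral_def
    using s by (intro lborel_integral_scaleR) auto
  also have "(\<lambda>x. indicator (sublevel (\<lambda>x. c * g x)) (s *\<^sub>R x) *\<^sub>R h (s *\<^sub>R x)) =
      (\<lambda>x. s powr r * (indicator (sublevel g) x *\<^sub>R h x))"
    using sd by (auto simp: fun_eq_iff indicator_def sublevel_def phf_scale[OF h s]
        phf_scale[OF phf s] mult.assoc[symmetric])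
  also have "\<bar>s\<bar> ^ DIM(real^'n) * (LINT x|lborel. s powr r * (indicator (sublevel g) x *\<^sub>R h x)) =
      s powr (real CARD('n) + r) * sublevel_integral h g"
    using s by (simp add: sublevel_integral_def set_lebesgue_integral_def powr_add powr_realpow)
  also have "s powr (real CARD('n) + r) = c powr (- (real CARD('n) + r) / d)"
    unfolding s_def powr_powr by (rule arg_cong[of _ _ "(powr) c"]) (use g(2) in \<open>simp add: field_simps\<close>)
  finally show ?thesis .
qed

section \<open>From integrals over sublevel sets to exponential integrals\<close>

lemma nn_integral_exp_tail:
  "(\<integral>\<^sup>+t. ennreal (exp (- t)) * indicator {a..} t \<partial>lborel) = ennreal (exp (- a))"
proof -
  have "((\<lambda>t::real. - exp (- t)) \<longlongrightarrow> 0) at_top"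
    using tendsto_minus[OF filterlim_compose[OF exp_at_bot filterlim_uminus_at_bot_at_top]] by simp
  then have "(\<integral>\<^sup>+t. ennreal (exp (- t)) * indicator {a..} t \<partial>lborel) = ennreal (0 - (- exp (- a)))"
    by (intro nn_integral_FTC_atLeast) (auto intro!: derivative_eq_intros)
  then show ?thesis by simp
qed

text \<open>For nonnegative \<open>\<phi>\<close> the order of integration can be exchanged in the
  extended nonnegative reals without prior integrability; the finite value on the right then yields
  integrability of the exponential integrand.\<close>

lemma laplace_sublevel_nn:
  fixes g \<phi> :: "real^'n \<Rightarrow> real"
  assumes \<phi>: "phf r \<phi>" "\<And>x. 0 \<le> \<phi> x" and r: "0 \<le> r" and g: "g \<in> phf_cone d" "d \<noteq> 0"
  shows "(\<integral>\<^sup>+x. ennreal (\<phi> x * exp (- g x)) \<partial>lborel) =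
    ennreal (Gamma (1 + (real CARD('n) + r) / d) * sublevel_integral \<phi> g)"
proof -
  define q where "q = (real CARD('n) + r) / d"
  have d: "d > 0" using phf_cone_degree_pos[OF g] .
  have q: "q \<ge> 0" using d r by (simp add: q_def)
  have phf: "phf d g" using g by (simp add: phf_cone_def)
  note [measurable] = phf_borel_measurable[OF phf] phf_borel_measurable[OF \<phi>(1)]
  have I: "sublevel_integral \<phi> g \<ge> 0"
    unfolding sublevel_integral_def set_lebesgue_integral_def
    using \<phi>(2) by (intro integral_nonneg_AE) auto
  have inner: "(\<integral>\<^sup>+x. ennreal (\<phi> x) * indicator {g x..} t \<partial>lborel) =
      ennreal (t powr q * sublevel_integral \<phi> g)" if t: "t > 0" for t
  proof -
    \<comment> \<open>The set where \<open>g x \<le> t\<close> is the sublevel set of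
      \<open>g / t\<close>, so the scaling law with factor \<open>1 / t\<close> produces the power
      \<open>t powr q\<close>.\<close>
    define gt where "gt = (\<lambda>x. (1 / t) * g x)"
    have gt: "gt \<in> phf_cone d"
      unfolding gt_def using t by (intro phf_cone_scale g) auto
    have "(\<integral>\<^sup>+x. ennreal (\<phi> x) * indicator {g x..} t \<partial>lborel) =
      (\<integral>\<^sup>+x. ennreal (indicator (sublevel gt) x *\<^sub>R \<phi> x) \<partial>lborel)"
      using t by (intro nn_integral_cong) (auto simp: indicator_def sublevel_def gt_def field_simps)
    also have "\<dots> = ennreal (sublevel_integral \<phi> gt)"
      unfolding sublevel_integral_def set_lebesgue_integral_def
      using set_integrable_sublevel[OF gt phf_continuous_on[OF \<phi>(1)]] \<phi>(2)
      by (intro nn_integral_eq_integral) (auto simp: set_integrable_def)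
    also have "sublevel_integral \<phi> gt = t powr q * sublevel_integral \<phi> g"
      unfolding gt_def using t
      by (subst sublevel_integral_scale[OF \<phi>(1) g])
        (simp_all add: q_def powr_divide powr_minus_divide minus_divide_left[symmetric] del: minus_add_distrib)
    finally show ?thesis .
  qed
  have neg: "(\<integral>\<^sup>+x. ennreal (\<phi> x) * indicator {g x..} t \<partial>lborel) = 0" if "t < 0" for t
  proof -
    have "t < g x" for x using phf_cone_nonneg[OF g, of x] that by linarith
    then have "indicator {g x..} t = (0::ennreal)" for x by (simp add: not_le)
    then show ?thesis by simp
  qed
  \<comment> \<open>The indicator is treated as a function of both variables, since the exchange of
    integrals needs its joint measurability.\<close>
  define J :: "real^'n \<Rightarrow> real \<Rightarrow> ennreal" where "J = (\<lambda>x. indicator {g x..})"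
  have J: "J x t = (if g x \<le> t then 1 else 0)" for x t by (simp add: J_def)
  have [measurable]: "case_prod J \<in> borel_measurable (lborel \<Otimes>\<^sub>M lborel)"
    unfolding J by measurable
  have "(\<integral>\<^sup>+x. ennreal (\<phi> x * exp (- g x)) \<partial>lborel) =
    (\<integral>\<^sup>+x. ennreal (\<phi> x) * (\<integral>\<^sup>+t. ennreal (exp (- t)) * J x t \<partial>lborel) \<partial>lborel)"
    unfolding J_def nn_integral_exp_tail using \<phi>(2) by (simp add: ennreal_mult)
  also have "\<dots> = (\<integral>\<^sup>+x. (\<integral>\<^sup>+t. ennreal (exp (- t)) * (ennreal (\<phi> x) * J x t) \<partial>lborel) \<partial>lborel)"
  proof (rule nn_integral_cong)
    fix x
    have "ennreal (\<phi> x) * (\<integral>\<^sup>+t. ennreal (exp (- t)) * J x t \<partial>lborel) =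
      (\<integral>\<^sup>+t. ennreal (\<phi> x) * (ennreal (exp (- t)) * J x t) \<partial>lborel)"
      by (rule nn_integral_cmult[symmetric]) measurable
    then show "ennreal (\<phi> x) * (\<integral>\<^sup>+t. ennreal (exp (- t)) * J x t \<partial>lborel) =
      (\<integral>\<^sup>+t. ennreal (exp (- t)) * (ennreal (\<phi> x) * J x t) \<partial>lborel)"
      by (simp add: mult.left_commute)
  qed
  also have "\<dots> = (\<integral>\<^sup>+t. (\<integral>\<^sup>+x. ennreal (exp (- t)) * (ennreal (\<phi> x) * J x t) \<partial>lborel) \<partial>lborel)"
    by (rule lborel_pair.Fubini') measurable
  also have "\<dots> = (\<integral>\<^sup>+t. ennreal (exp (- t)) * (\<integral>\<^sup>+x. ennreal (\<phi> x) * J x t \<partial>lborel) \<partial>lborel)"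
    by (intro nn_integral_cong nn_integral_cmult) measurable
  \<comment> \<open>The exponent is written as \<open>(1 + q) - 1\<close> to match Euler's integral
    for \<open>Gamma (1 + q)\<close>. Negative \<open>t\<close> contribute nothing because
    \<open>g\<close> is nonnegative, and the remaining point 0 is a null set.\<close>
  also have "\<dots> = (\<integral>\<^sup>+t. ennreal (indicator {0..} t * t powr ((1 + q) - 1) / exp t) *
      ennreal (sublevel_integral \<phi> g) \<partial>lborel)"
  proof (rule nn_integral_cong_AE, rule eventually_mono[OF AE_lborel_singleton[of 0]])
    fix t :: real assume "t \<noteq> 0"
    then show "ennreal (exp (- t)) * (\<integral>\<^sup>+x. ennreal (\<phi> x) * J x t \<partial>lborel) =
      ennreal (indicator {0..} t * t powr ((1 + q) - 1) / exp t) * ennreal (sublevel_integral \<phi> g)"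
      using neg[of t] inner[of t] I
      by (cases "t < 0") (auto simp: J_def ennreal_mult[symmetric] exp_minus field_simps)
  qed
  also have "\<dots> = ennreal (Gamma (1 + q)) * ennreal (sublevel_integral \<phi> g)"
    using q by (subst nn_integral_multc) (auto simp: Gamma_conv_nn_integral_real)
  finally show ?thesis
    using q I by (simp add: ennreal_mult q_def)
qed

text \<open>For \<open>r < 0\<close> the argument of \<open>Gamma\<close> may be a pole, where \<open>Gamma\<close> is \<open>0\<close> by convention, but
  then \<open>\<phi> = 0\<close> and both sides vanish.\<close>

lemma laplace_sublevel:
  fixes g \<phi> :: "real^'n \<Rightarrow> real"
  assumes \<phi>: "phf r \<phi>" and g: "g \<in> phf_cone d" "d \<noteq> 0"
  shows "integrable lborel (\<lambda>x. \<phi> x * exp (- g x))" (is ?int)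
    and "(LINT x|lborel. \<phi> x * exp (- g x)) =
      Gamma (1 + (real CARD('n) + r) / d) * sublevel_integral \<phi> g" (is ?eq)
    and "sublevel_integral \<phi> g =
      1 / Gamma (1 + (real CARD('n) + r) / d) * (LINT x|lborel. \<phi> x * exp (- g x))" (is ?inv)
proof -
  have "?int \<and> ?eq \<and> ?inv"
  proof (cases "\<forall>x. \<phi> x = 0")
    case True
    then show ?thesis by (simp add: sublevel_integral_def)
  next
    case False
    then have r: "0 \<le> r" using phf_degree_nonneg[OF \<phi>] by blast
    have d: "d > 0" using phf_cone_degree_pos[OF g] .
    define G where "G = Gamma (1 + (real CARD('n) + r) / d)"
    have G: "G > 0"
      unfolding G_def using r d by (intro Gamma_real_pos add_pos_nonneg) auto
    have phf: "phf d g" using g by (simp add: phf_cone_def)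
    note [measurable] = phf_borel_measurable[OF phf]
    have nonneg: "integrable lborel (\<lambda>x. \<psi> x * exp (- g x))"
        "(LINT x|lborel. \<psi> x * exp (- g x)) = G * sublevel_integral \<psi> g"
      if \<psi>: "phf r \<psi>" "\<And>x. 0 \<le> \<psi> x" for \<psi>
    proof -
      note [measurable] = phf_borel_measurable[OF \<psi>(1)]
      have "sublevel_integral \<psi> g \<ge> 0"
        unfolding sublevel_integral_def set_lebesgue_integral_def
        using \<psi>(2) by (intro integral_nonneg_AE) auto
      then have "has_bochner_integral lborel (\<lambda>x. \<psi> x * exp (- g x)) (G * sublevel_integral \<psi> g)"
        using laplace_sublevel_nn[OF \<psi> r g] \<psi>(2) G
        by (intro has_bochner_integral_nn_integral) (auto simp: G_def)
      then show "integrable lborel (\<lambda>x. \<psi> x * exp (- g x))"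
        "(LINT x|lborel. \<psi> x * exp (- g x)) = G * sublevel_integral \<psi> g"
        by (auto simp: has_bochner_integral_iff)
    qed
    \<comment> \<open>Positive and negative parts of \<open>\<phi>\<close> are again positively
      homogeneous of degree \<open>r\<close>, so the nonnegative case applies to each and the
      general one follows by linearity.\<close>
    define a where "a = (\<lambda>x. max (\<phi> x) 0)"
    define b where "b = (\<lambda>x. max (- \<phi> x) 0)"
    have a: "phf r a" "\<And>x. 0 \<le> a x" and b: "phf r b" "\<And>x. 0 \<le> b x"
      unfolding a_def b_def using phf_max_zero[OF \<phi>] phf_max_zero[OF phf_cmult[OF \<phi>, of "-1"]] by auto
    have \<phi>_eq: "\<phi> = (\<lambda>x. a x - b x)"
      by (auto simp: a_def b_def fun_eq_iff)
    have 1: "sublevel_integral \<phi> g = sublevel_integral a g - sublevel_integral b g"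
      unfolding \<phi>_eq sublevel_integral_def using a b
      by (intro set_integral_diff(2) set_integrable_sublevel[OF g(1)] phf_continuous_on) auto
    have eq: "?eq" and ?int
      using nonneg[OF a] nonneg[OF b] unfolding 1 by (auto simp: \<phi>_eq left_diff_distrib right_diff_distrib G_def)
    then show ?thesis using G by (simp add: G_def)
  qed
  then show ?int ?eq ?inv by blast+
qed

section \<open>Convexity\<close>

text \<open>If the integrals agreed, the nonnegative difference would vanish almost everywhere. By
  continuity the set of agreement is closed, and a closed set of full Lebesgue measure is the whole
  space.\<close>

lemma lborel_integral_strict_mono:
  fixes F G :: "'a::euclidean_space \<Rightarrow> real"
  assumes F: "integrable lborel F" "continuous_on UNIV F"
    and G: "integrable lborel G" "continuous_on UNIV G"
    and le: "\<And>x. F x \<le> G x" and less: "F x0 < G x0"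
  shows "integral\<^sup>L lborel F < integral\<^sup>L lborel G"
proof -
  have "integral\<^sup>L lborel F \<noteq> integral\<^sup>L lborel G"
  proof
    assume "integral\<^sup>L lborel F = integral\<^sup>L lborel G"
    then have "(LINT x|lborel. G x - F x) = 0"
      using F G by simp
    then have "AE x in lborel. G x - F x = 0"
      using F G le by (subst (asm) integral_nonneg_eq_0_iff_AE) auto
    then have "AE x in lebesgue. x \<in> {x. G x = F x}"
      by (intro AE_completion) auto
    moreover have "closed {x. G x = F x}"
      using F G by (intro closed_Collect_eq)
    ultimately have "x0 \<in> {x. G x = F x}"
      using mem_closed_if_AE_lebesgue by blast
    then show False using less by simp
  qed
  moreover have "integral\<^sup>L lborel F \<le> integral\<^sup>L lborel G"
    using F G le by (intro integral_mono)
  ultimately show ?thesis by simp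
qed

lemma exp_convex_combination:
  fixes a b u v :: real
  assumes "0 \<le> u" "0 \<le> v" "u + v = 1"
  shows "exp (u * a + v * b) \<le> u * exp a + v * exp b"
proof -
  have u: "u = 1 - v" using assms by simp
  show ?thesis
    unfolding u using convex_onD[OF exp_convex, of v a b] assms by simp
qed

text \<open>Off its point of contact the tangent at the weighted mean lies strictly below the graph.
  Averaging the tangent inequalities at \<open>a\<close> and \<open>b\<close> cancels the linear
  terms and leaves \<open>exp m\<close>.\<close>

lemma exp_strictly_convex_combination:
  fixes a b u v :: real
  assumes "0 < u" "0 < v" "u + v = 1" "a \<noteq> b"
  shows "exp (u * a + v * b) < u * exp a + v * exp b"
proof -
  define m where "m = u * a + v * b"
  have tangent: "exp m * (1 + (z - m)) < exp z" if "z \<noteq> m" for z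
  proof -
    have "1 + (z - m) < exp (z - m)"
      using exp_minus_greater[of "m - z"] that by simp
    then have "exp m * (1 + (z - m)) < exp m * exp (z - m)" by simp
    then show ?thesis by (simp add: exp_diff)
  qed
  have v: "v = 1 - u" using assms by simp
  have "a - m = v * (a - b)" "b - m = u * (b - a)"
    by (simp_all add: m_def v algebra_simps)
  then have "a \<noteq> m" "b \<noteq> m"
    using assms by auto
  then have "u * (exp m * (1 + (a - m))) + v * (exp m * (1 + (b - m))) < u * exp a + v * exp b"
    using assms by (intro add_strict_mono mult_strict_left_mono tangent)
  moreover have "u * (exp m * (1 + (a - m))) + v * (exp m * (1 + (b - m))) = exp m"
    by (simp add: m_def v algebra_simps)
  ultimately show ?thesis by (simp add: m_def)
qed

text \<open>The functional is a constant multiple of the integral of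
  \<open>h x * exp (- g x)\<close>, into which \<open>g\<close> enters only through a convex
  function. A single point with \<open>h > 0\<close> and distinct values of \<open>g1\<close>,
  \<open>g2\<close> suffices for strictness; this pointwise form serves both the full cone and the
  forms.\<close>

lemma sublevel_integral_convex:
  fixes g1 g2 h :: "real^'n \<Rightarrow> real"
  assumes h: "phf r h" "\<And>x. 0 \<le> h x" and d: "d \<noteq> 0"
    and g: "g1 \<in> phf_cone d" "g2 \<in> phf_cone d" and uv: "0 \<le> u" "0 \<le> v" "u + v = 1"
  shows "sublevel_integral h (\<lambda>x. u * g1 x + v * g2 x) \<le>
    u * sublevel_integral h g1 + v * sublevel_integral h g2"
    and "\<lbrakk>0 < u; 0 < v; 0 < h x0; g1 x0 \<noteq> g2 x0\<rbrakk> \<Longrightarrow>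
      sublevel_integral h (\<lambda>x. u * g1 x + v * g2 x) <
      u * sublevel_integral h g1 + v * sublevel_integral h g2"
proof -
  define g where "g = (\<lambda>x. u * g1 x + v * g2 x)"
  define G where "G = 1 / Gamma (1 + (real CARD('n) + r) / d)"
  have cone: "g \<in> phf_cone d"
    using convex_function_set_phf_cone[OF d] g uv unfolding convex_function_set_def g_def by blast
  define F1 where "F1 = (\<lambda>x. h x * exp (- g x))"
  define F2 where "F2 = (\<lambda>x. u * (h x * exp (- g1 x)) + v * (h x * exp (- g2 x)))"
  have F1: "integrable lborel F1" "sublevel_integral h g = G * integral\<^sup>L lborel F1"
    using laplace_sublevel[OF h(1) cone d] unfolding F1_def G_def by blast+
  have F2: "integrable lborel F2"
    "u * sublevel_integral h g1 + v * sublevel_integral h g2 = G * integral\<^sup>L lborel F2"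
    using laplace_sublevel(1,3)[OF h(1) g(1) d] laplace_sublevel(1,3)[OF h(1) g(2) d]
    unfolding F2_def G_def by (auto simp: algebra_simps add_divide_distrib)
  have F2_eq: "F2 x = h x * (u * exp (- g1 x) + v * exp (- g2 x))" for x
    by (simp add: F2_def algebra_simps)
  have g_eq: "- g x = u * (- g1 x) + v * (- g2 x)" for x
    by (simp add: g_def)
  have le: "F1 x \<le> F2 x" for x
    unfolding F1_def F2_eq g_eq by (intro mult_left_mono exp_convex_combination uv h(2))
  \<comment> \<open>A nonzero value of \<open>h\<close> makes its degree nonnegative, which keeps
    the argument of \<open>Gamma\<close> positive; identically zero \<open>h\<close> is treated
    separately below.\<close>
  have Gpos: "G > 0" if "h x \<noteq> 0" for x
    unfolding G_def using phf_degree_nonneg[OF h(1) that] phf_cone_degree_pos[OF g(1) d]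
    by (intro divide_pos_pos Gamma_real_pos add_pos_nonneg) auto
  have "sublevel_integral h g \<le> u * sublevel_integral h g1 + v * sublevel_integral h g2"
  proof (cases "\<exists>x. h x \<noteq> 0")
    case True
    then have "G > 0" using Gpos by blast
    then show ?thesis
      unfolding F1 F2 by (intro mult_left_mono integral_mono F1 F2 le) auto
  next
    case False
    then show ?thesis by (simp add: sublevel_integral_def)
  qed
  then show "sublevel_integral h (\<lambda>x. u * g1 x + v * g2 x) \<le>
    u * sublevel_integral h g1 + v * sublevel_integral h g2" by (simp add: g_def)
  assume *: "0 < u" "0 < v" "0 < h x0" "g1 x0 \<noteq> g2 x0"
  have cont: "continuous_on UNIV h" "continuous_on UNIV g1" "continuous_on UNIV g2"
    using h(1) g by (auto simp: phf_cone_def phf_def)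
  have "F1 x0 < F2 x0"
    unfolding F1_def F2_eq g_eq using * uv
    by (intro mult_strict_left_mono exp_strictly_convex_combination) auto
  then have "integral\<^sup>L lborel F1 < integral\<^sup>L lborel F2"
    using F1 F2 le cont
    by (intro lborel_integral_strict_mono[of F1 F2 x0])
      (auto simp: F1_def F2_def g_def intro!: continuous_intros)
  then have "sublevel_integral h g < u * sublevel_integral h g1 + v * sublevel_integral h g2"
    unfolding F1 F2 using Gpos[of x0] * by simp
  then show "sublevel_integral h (\<lambda>x. u * g1 x + v * g2 x) <
    u * sublevel_integral h g1 + v * sublevel_integral h g2" by (simp add: g_def)
qed

section \<open>Homogeneity and convexity on the cone\<close>

lemma sublevel_integral_homogeneous_on_phf_cone:
  fixes h :: "real^'n \<Rightarrow> real"
  assumes "phf p h" "d \<noteq> 0"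
  shows "homogeneous_functional_on (phf_cone d) (- (real CARD('n) + p) / d) (sublevel_integral h)"
  unfolding homogeneous_functional_on_def
  using sublevel_integral_scale[OF assms(1) _ assms(2)] phf_cone_scale[OF _ assms(2)] by blast

lemma sublevel_integral_convex_on_phf_cone:
  fixes h :: "real^'n \<Rightarrow> real"
  assumes "phf p h" "d \<noteq> 0" "\<And>x. 0 \<le> h x"
  shows "convex_functional_on (phf_cone d) (sublevel_integral h)"
  unfolding convex_functional_on_def
  using sublevel_integral_convex(1)[OF assms(1,3,2)] convex_function_set_phf_cone[OF assms(2)]
  by blast

lemma sublevel_integral_strictly_convex_on_phf_cone:
  fixes h :: "real^'n \<Rightarrow> real"
  assumes h: "phf p h" "\<And>x. x \<noteq> 0 \<Longrightarrow> 0 < h x" and d: "d \<noteq> 0"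
  shows "strictly_convex_functional_on (phf_cone d) (sublevel_integral h)"
  unfolding strictly_convex_functional_on_def
proof (intro conjI ballI allI impI convex_function_set_phf_cone d)
  fix g1 g2 :: "real^'n \<Rightarrow> real" and u v :: real
  assume g: "g1 \<in> phf_cone d" "g2 \<in> phf_cone d" and uv: "0 < u" "0 < v"
    and ne: "g1 \<noteq> g2 \<and> u + v = 1"
  \<comment> \<open>Positivity is given off the origin; density of that set and continuity carry
    nonnegativity to the origin.\<close>
  have "closure (- {0}) = (UNIV :: (real^'n) set)"
    by (simp add: closure_complement)
  then have "h x \<ge> 0" for x
    using continuous_ge_on_closure[OF phf_continuous_on[OF h(1)], of x "- {0}" 0] h(2)
    by (simp add: less_imp_le)
  moreover obtain x where x: "g1 x \<noteq> g2 x" using ne by blast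
  \<comment> \<open>Both functions vanish at the origin, so they can differ only where
    \<open>h\<close> is positive.\<close>
  moreover have "x \<noteq> 0"
    using x phf_at_zero[of d g1] phf_at_zero[of d g2] g d by (auto simp: phf_cone_def)
  ultimately show "sublevel_integral h (\<lambda>x. u * g1 x + v * g2 x) <
      u * sublevel_integral h g1 + v * sublevel_integral h g2"
    using h(2)[of x] uv ne by (intro sublevel_integral_convex(2)[OF h(1) _ d g, of u v x]) auto
qed

section \<open>Forms\<close>

lemma univariate_sum_eq_zero_imp_coeff:
  fixes a :: "nat \<Rightarrow> real"
  assumes "infinite T" and zero: "\<And>t. t \<in> T \<Longrightarrow> (\<Sum>m\<le>N. a m * t ^ m) = 0" and "m \<le> N"
  shows "a m = 0"
proof (rule ccontr)
  assume "a m \<noteq> 0"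
  then have "finite {t. (\<Sum>m\<le>N. a m * t ^ m) = 0}"
    using polyfun_roots_finite[of a m N] \<open>m \<le> N\<close> by simp
  moreover have "T \<subseteq> {t. (\<Sum>m\<le>N. a m * t ^ m) = 0}"
    using zero by blast
  ultimately show False
    using \<open>infinite T\<close> finite_subset by blast
qed

text \<open>The exponents \<open>e i\<close> may coincide on \<open>S\<close>, so only the sum of the coefficients in each class is
  determined; this is what makes the induction on \<open>S\<close> go through.\<close>

lemma monomial_sum_eq_zero_imp_coeffs:
  fixes a :: "'m \<Rightarrow> real" and e :: "'m \<Rightarrow> 'n \<Rightarrow> nat" and B :: "'n \<Rightarrow> real set"
  assumes "finite S" "finite I" and "\<And>j. infinite (B j)"
    and "\<And>x. (\<And>j. x j \<in> B j) \<Longrightarrow> (\<Sum>i\<in>I. a i * (\<Prod>j\<in>S. x j ^ e i j)) = 0"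
  shows "(\<Sum>i | i \<in> I \<and> (\<forall>j\<in>S. e i j = b j). a i) = 0"
  using assms(1,2,4)
proof (induction S arbitrary: I rule: finite_induct)
  case empty
  have "\<exists>t. t \<in> B j" for j
    using infinite_imp_nonempty[OF assms(3)] by blast
  then obtain x where "\<And>j. x j \<in> B j" by metis
  then show ?case using empty.prems(2)[of x] by simp
next
  case (insert s S)
  define I' where "I' = {i \<in> I. e i s = b s}"
  have fin: "finite I'" using insert.prems(1) by (simp add: I'_def)
  have "(\<Sum>i\<in>I'. a i * (\<Prod>j\<in>S. x j ^ e i j)) = 0" if x: "\<And>j. x j \<in> B j" for x
  proof -
    \<comment> \<open>The exponent \<open>b s\<close> enters the maximum because it need not occur
      in \<open>I\<close>, yet its coefficient must lie in the summation range.\<close>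
    define N where "N = Max (insert (b s) ((\<lambda>i. e i s) ` I))"
    have N: "b s \<le> N" "\<And>i. i \<in> I \<Longrightarrow> e i s \<le> N"
      using insert.prems(1) by (auto simp: N_def)
    \<comment> \<open>With the variables in \<open>S\<close> frozen, \<open>A m\<close> is the
      coefficient of \<open>t ^ m\<close> in the variable belonging to \<open>s\<close>. The
      polynomial vanishes on the infinite set \<open>B s\<close>, so each coefficient is 0, in
      particular the one for \<open>b s\<close>.\<close>
    define A where "A m = (\<Sum>i | i \<in> I \<and> e i s = m. a i * (\<Prod>j\<in>S. x j ^ e i j))" for m
    have "A (b s) = 0"
    proof (rule univariate_sum_eq_zero_imp_coeff[where T = "B s"])
      fix t assume t: "t \<in> B s"
      have "(\<Sum>m\<le>N. A m * t ^ m) =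
        (\<Sum>m\<le>N. \<Sum>i | i \<in> I \<and> e i s = m. a i * (\<Prod>j\<in>S. x j ^ e i j) * t ^ e i s)"
        by (simp add: A_def sum_distrib_right)
      also have "\<dots> = (\<Sum>i\<in>I. a i * (\<Prod>j\<in>S. x j ^ e i j) * t ^ e i s)"
        using insert.prems(1) N(2) by (intro sum.group) auto
      also have "\<dots> = (\<Sum>i\<in>I. a i * (\<Prod>j\<in>insert s S. (x(s := t)) j ^ e i j))"
      proof (intro sum.cong refl)
        fix i
        have "(\<Prod>j\<in>S. (x(s := t)) j ^ e i j) = (\<Prod>j\<in>S. x j ^ e i j)"
          using insert.hyps(2) by (intro prod.cong) auto
        then show "a i * (\<Prod>j\<in>S. x j ^ e i j) * t ^ e i s =
            a i * (\<Prod>j\<in>insert s S. (x(s := t)) j ^ e i j)"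
          using insert.hyps by simp
      qed
      also have "\<dots> = 0"
        using x t by (intro insert.prems(2)) auto
      finally show "(\<Sum>m\<le>N. A m * t ^ m) = 0" .
    qed (use assms(3) N in auto)
    then show ?thesis by (simp add: A_def I'_def)
  qed
  from insert.IH[OF fin this] show ?case
    by (simp add: I'_def conj_assoc)
qed

lemma continuous_on_mono_eval [continuous_intros]: "continuous_on S (mono_eval \<alpha>)"
  unfolding mono_eval_def by (intro continuous_intros)

lemma mono_eval_add: "mono_eval (\<alpha> + \<beta>) x = mono_eval \<alpha> x * mono_eval \<beta> x"
  by (simp add: mono_eval_def power_add prod.distrib)

lemma form_add: "form mon (c + c') x = form mon c x + form mon c' x"
  by (simp add: form_def sum.distrib distrib_right)

lemma form_scale: "form mon (a *\<^sub>R c) x = a * form mon c x"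
  by (simp add: form_def sum_distrib_left mult.assoc)

lemma form_axis: "form mon (axis i 1) x = mono_eval (mon i) x"
  by (simp add: form_def axis_def if_distrib[of "\<lambda>t. t * _"] cong: if_cong)

text \<open>An open set contains a nonempty open box, whose sides are infinite, so the preceding
  lemma applies. Injectivity of \<open>mon\<close> makes every class of equal exponents a singleton
  and thus isolates the individual coefficients.\<close>

lemma form_eq_zero_on_open_imp_zero:
  fixes mon :: "'m::finite \<Rightarrow> nat^'n"
  assumes mon: "inj mon" and U: "open U" "x0 \<in> U"
    and zero: "\<And>x. x \<in> U \<Longrightarrow> form mon c x = 0"
  shows "c = 0"
proof -
  obtain r where r: "r > 0" "ball x0 r \<subseteq> U"
    using U by (auto simp: open_contains_ball)
  obtain a b where "x0 \<in> box a b" "box a b \<subseteq> ball x0 r"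
    using rational_boxes[OF r(1)] by blast
  then have ab: "box a b \<subseteq> U" "a $ j < b $ j" for j
    using r(2) by (auto simp: mem_box_cart dest: less_trans)
  have "c $ i = 0" for i
  proof -
    have "(\<Sum>i' | i' \<in> UNIV \<and> (\<forall>j\<in>UNIV. mon i' $ j = mon i $ j). c $ i') = 0"
    proof (rule monomial_sum_eq_zero_imp_coeffs[where B = "\<lambda>j. {a $ j <..< b $ j}"])
      fix x :: "'n \<Rightarrow> real" assume "\<And>j. x j \<in> {a $ j <..< b $ j}"
      then have "(\<chi> j. x j) \<in> box a b" by (simp add: mem_box_cart)
      then show "(\<Sum>i\<in>UNIV. c $ i * (\<Prod>j\<in>UNIV. x j ^ (mon i $ j))) = 0"
        using zero ab(1) by (fastforce simp: form_def mono_eval_def)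
    next
      show "infinite {a $ j <..< b $ j}" for j
        using ab(2)[of j] by (simp add: infinite_Ioo)
    qed auto
    moreover have "{i'. i' \<in> UNIV \<and> (\<forall>j\<in>UNIV. mon i' $ j = mon i $ j)} = {i}"
      using mon by (auto simp: vec_eq_iff[symmetric] inj_eq)
    ultimately show ?thesis by simp
  qed
  then show ?thesis by (simp add: vec_eq_iff)
qed

section \<open>Differentiation in the coefficients\<close>

text \<open>Chain rule along a coordinate line: a Frechet derivative makes the value of
  \<open>deriv\<close> genuine.\<close>

lemma partial_deriv_has_derivative:
  assumes "(F has_derivative D) (at c)"
  shows "partial_deriv i F c = D (axis i 1)"
proof -
  have "((\<lambda>t::real. c + t *\<^sub>R axis i 1) has_derivative (\<lambda>t. t *\<^sub>R axis i 1)) (at 0)"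
    by (auto intro!: derivative_eq_intros)
  then have "((\<lambda>t. F (c + t *\<^sub>R axis i 1)) has_derivative (\<lambda>t. D (t *\<^sub>R axis i 1))) (at 0)"
    using assms by (intro has_derivative_compose[of _ _ 0 UNIV F D]) simp_all
  moreover have "(\<lambda>t. D (t *\<^sub>R axis i 1)) = (*) (D (axis i 1))"
    using linear_scale[OF has_derivative_linear[OF assms]] by (simp add: fun_eq_iff)
  ultimately show ?thesis
    unfolding partial_deriv_def by (intro DERIV_imp_deriv) (simp add: has_field_derivative_def)
qed

lemma gradient_differentiable:
  assumes "\<And>i. partial_deriv i F differentiable (at c)"
  shows "gradient F differentiable (at c)"
proof -
  have "gradient F = (\<lambda>c. \<Sum>i\<in>UNIV. partial_deriv i F c *\<^sub>R axis i 1)"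
    by (auto simp: fun_eq_iff vec_eq_iff gradient_def axis_def if_distrib[of "\<lambda>t. _ * t"] cong: if_cong)
  then show ?thesis
    using assms by (auto intro!: differentiable_sum differentiable_scaleR)
qed

text \<open>Lagrange remainder of order two. The factor \<open>exp \<bar>b\<bar>\<close> is harmless
  later, since part of the decay of the exponential weight absorbs it.\<close>

lemma exp_quadratic_remainder:
  fixes b :: real
  shows "\<bar>exp (- b) - 1 + b\<bar> \<le> b\<^sup>2 * exp \<bar>b\<bar>"
proof -
  obtain t where t: "\<bar>t\<bar> \<le> \<bar>- b\<bar>" "exp (- b) = (\<Sum>m<2. (- b) ^ m / fact m) + exp t / fact 2 * (- b)\<^sup>2"
    using Maclaurin_exp_le[of "- b" 2] by blast
  then have eq: "exp (- b) - 1 + b = exp t / 2 * b\<^sup>2"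
    by (simp add: numeral_2_eq_2)
  have "exp t / 2 \<le> exp \<bar>b\<bar>"
  proof -
    have "exp t \<le> exp \<bar>b\<bar>" using t(1) by simp
    moreover have "0 < exp t" by simp
    ultimately show ?thesis by linarith
  qed
  then have "exp t / 2 * b\<^sup>2 \<le> exp \<bar>b\<bar> * b\<^sup>2"
    by (intro mult_right_mono) auto
  then show ?thesis
    unfolding eq by (simp add: abs_mult mult.commute)
qed

section \<open>Forms as positively homogeneous functions\<close>

lemma mono_eval_scaleR: "mono_eval \<alpha> (c *\<^sub>R x) = c ^ multi_degree \<alpha> * mono_eval \<alpha> x"
  unfolding mono_eval_def multi_degree_def power_sum
  by (simp add: power_mult_distrib prod.distrib)

lemma phf_mono_eval: "phf (real (multi_degree \<alpha>)) (mono_eval \<alpha>)"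
  unfolding phf_def by (simp add: continuous_on_mono_eval mono_eval_scaleR powr_realpow)

lemma multi_degree_enumerated: "enumerates_degree k mon \<Longrightarrow> multi_degree (mon i) = k"
  unfolding enumerates_degree_def bij_betw_def by blast

lemma phf_mono_eval_enumerated: "enumerates_degree k mon \<Longrightarrow> phf (real k) (mono_eval (mon i))"
  using phf_mono_eval[of "mon i"] multi_degree_enumerated by metis

lemma phf_form:
  assumes "enumerates_degree k mon"
  shows "phf (real k) (form mon c)"
  using phf_mono_eval_enumerated[OF assms] unfolding phf_def form_def
  by (auto intro!: continuous_intros simp: sum_distrib_left mult_ac)

text \<open>A form is continuous, so its sublevel set is closed, and compactness amounts to
  boundedness. Results on the functional cone thereby apply to coefficient vectors.\<close>

lemma form_cone_iff_phf_cone: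
  assumes "enumerates_degree k mon"
  shows "c \<in> form_cone mon \<longleftrightarrow> form mon c \<in> phf_cone (real k)"
  using phf_form[OF assms, of c] compact_sublevel[of "form mon c"] compact_imp_bounded
  by (auto simp: form_cone_def phf_cone_def)

lemma convex_form_cone:
  fixes mon :: "'m::finite \<Rightarrow> nat^'n"
  assumes mon: "enumerates_degree k mon" and "k \<noteq> 0"
  shows "convex (form_cone mon)"
proof (rule convexI)
  fix c c' :: "real^'m" and u v :: real
  assume "c \<in> form_cone mon" "c' \<in> form_cone mon" and uv: "0 \<le> u" "0 \<le> v" "u + v = 1"
  then have "(\<lambda>x. u * form mon c x + v * form mon c' x) \<in> phf_cone (real k)"
    using convex_function_set_phf_cone[of "real k", where 'n = 'n] \<open>k \<noteq> 0\<close>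
    unfolding convex_function_set_def form_cone_iff_phf_cone[OF mon] by simp
  also have "(\<lambda>x. u * form mon c x + v * form mon c' x) = form mon (u *\<^sub>R c + v *\<^sub>R c')"
    by (simp add: fun_eq_iff form_add form_scale)
  finally show "u *\<^sub>R c + v *\<^sub>R c' \<in> form_cone mon"
    by (simp add: form_cone_iff_phf_cone[OF mon])
qed

lemma form_upper_bound:
  fixes mon :: "'m::finite \<Rightarrow> nat^'n"
  assumes mon: "enumerates_degree k mon" and "k \<noteq> 0"
  shows "\<exists>K>0. \<forall>v x. \<bar>form mon v x\<bar> \<le> K * norm v * norm x powr real k"
proof -
  have "\<forall>i. \<exists>K\<ge>0. \<forall>x. \<bar>mono_eval (mon i) x\<bar> \<le> K * norm x powr real k"
    using phf_upper_bound[OF phf_mono_eval_enumerated[OF mon]] \<open>k \<noteq> 0\<close> by simp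
  then obtain K where K: "\<And>i. K i \<ge> 0"
    "\<And>i x. \<bar>mono_eval (mon i) x\<bar> \<le> K i * norm x powr real k" by metis
  have "\<bar>form mon v x\<bar> \<le> ((\<Sum>i\<in>UNIV. K i) + 1) * norm v * norm x powr real k" for v x
  proof -
    have "\<bar>form mon v x\<bar> \<le> (\<Sum>i\<in>UNIV. \<bar>v $ i\<bar> * \<bar>mono_eval (mon i) x\<bar>)"
      unfolding form_def abs_mult[symmetric] by (rule sum_abs)
    also have "\<dots> \<le> (\<Sum>i\<in>UNIV. norm v * (K i * norm x powr real k))"
      by (intro sum_mono mult_mono component_le_norm_cart K) auto
    also have "\<dots> = (\<Sum>i\<in>UNIV. K i) * norm v * norm x powr real k"
      by (simp add: sum_distrib_left sum_distrib_right mult_ac)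
    \<comment> \<open>Adding 1 makes the constant strictly positive, so that it can serve as a
      divisor in the choice of a radius.\<close>
    also have "\<dots> \<le> ((\<Sum>i\<in>UNIV. K i) + 1) * norm v * norm x powr real k"
      by (intro mult_right_mono) auto
    finally show ?thesis .
  qed
  moreover have "(\<Sum>i\<in>UNIV. K i) + 1 > 0"
    using K(1) by (simp add: add_nonneg_pos sum_nonneg)
  ultimately show ?thesis by blast
qed

lemma has_derivative_quadratic_remainder:
  fixes F D :: "'a::real_normed_vector \<Rightarrow> real"
  assumes "bounded_linear D" "\<delta> > 0"
    and rem: "\<And>v. norm v \<le> \<delta> \<Longrightarrow> \<bar>F (c + v) - F c - D v\<bar> \<le> C * (norm v)\<^sup>2"
  shows "(F has_derivative D) (at c)"
  unfolding has_derivative_at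
proof (intro conjI assms(1))
  have "((\<lambda>v::'a. C * norm v) \<longlongrightarrow> C * norm (0::'a)) (at 0)"
    by (intro tendsto_intros)
  then have "((\<lambda>v::'a. C * norm v) \<longlongrightarrow> 0) (at 0)" by simp
  moreover have "\<forall>\<^sub>F v in at 0. norm (norm (F (c + v) - F c - D v) / norm v) \<le> C * norm v"
    unfolding eventually_at
  proof (intro exI[of _ \<delta>] conjI assms(2) ballI impI)
    fix v :: 'a assume "v \<noteq> 0 \<and> dist v 0 < \<delta>"
    then show "norm (norm (F (c + v) - F c - D v) / norm v) \<le> C * norm v"
      using rem[of v] by (simp add: divide_le_eq power2_eq_square mult.assoc)
  qed
  ultimately show "(\<lambda>v. norm (F (c + v) - F c - D v) / norm v) \<midarrow>0\<rightarrow> 0"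
    by (rule Lim_null_comparison[rotated])
qed

text \<open>The first-order error of the integrand is bounded pointwise by
  \<open>(norm v)\<^sup>2\<close> times one fixed integrable function, valid for all small
  \<open>v\<close>. Integration gives a quadratic remainder, hence Frechet
  differentiability.\<close>

lemma exp_integral_has_derivative:
  fixes \<phi> :: "real^'n \<Rightarrow> real" and mon :: "'m::finite \<Rightarrow> nat^'n"
  assumes \<phi>: "phf r \<phi>" and mon: "enumerates_degree k mon" and k: "k \<noteq> 0"
    and c: "c \<in> form_cone mon"
  shows "((\<lambda>c. LINT x|lborel. \<phi> x * exp (- form mon c x)) has_derivative
    (\<lambda>v. - (LINT x|lborel. \<phi> x * form mon v x * exp (- form mon c x)))) (at c)"
proof -
  define N where "N = (\<lambda>x::real^'n. norm x powr real k)"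
  have N: "phf (real k) N" "\<And>x. N x \<ge> 0" "\<And>x. x \<noteq> 0 \<Longrightarrow> N x > 0"
    using phf_norm_powr[of "real k"] k by (auto simp: N_def)
  have cone: "form mon c \<in> phf_cone (real k)"
    using c by (simp add: form_cone_iff_phf_cone[OF mon])
  obtain m where m: "m > 0" "\<And>x. m * N x \<le> form mon c x"
    using phf_pos_lower_bound[OF phf_form[OF mon] _ phf_cone_pos[OF cone]] k by (auto simp: N_def)
  obtain K where K: "K > 0" "\<And>v x. \<bar>form mon v x\<bar> \<le> K * norm v * N x"
    using form_upper_bound[OF mon k] by (auto simp: N_def)
  \<comment> \<open>Half of the lower bound for \<open>form mon c\<close>: the other half is
    reserved for absorbing a perturbation \<open>form mon v\<close>.\<close>
  define g where "g = (\<lambda>x. (m / 2) * N x)"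
  have g: "g \<in> phf_cone (real k)"
    unfolding g_def using m N k by (intro phf_coneI phf_cmult) auto
  define R where "R = (LINT x|lborel. \<bar>\<phi> x\<bar> * (N x * N x) * exp (- g x))"
  \<comment> \<open>The dominating function is again a positively homogeneous function times
    \<open>exp (- g)\<close> with \<open>g\<close> in the cone, so the Laplace identity supplies its
    integrability.\<close>
  have intR: "integrable lborel (\<lambda>x. \<bar>\<phi> x\<bar> * (N x * N x) * exp (- g x))"
    using laplace_sublevel(1)[OF phf_mult[OF phf_abs[OF \<phi>] phf_mult[OF N(1) N(1)]] g] k by simp
  have int0: "integrable lborel (\<lambda>x. \<phi> x * exp (- form mon c x))"
    using laplace_sublevel(1)[OF \<phi> cone] k by simp
  have int1: "integrable lborel (\<lambda>x. \<phi> x * form mon v x * exp (- form mon c x))" for v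
    using laplace_sublevel(1)[OF phf_mult[OF \<phi> phf_form[OF mon]] cone] k by simp
  show ?thesis
  \<comment> \<open>The radius ensures \<open>K * norm v \<le> m / 2\<close>, so
    \<open>\<bar>form mon v x\<bar>\<close> never exceeds the reserved half
    \<open>(m / 2) * N x\<close>.\<close>
  proof (rule has_derivative_quadratic_remainder[where \<delta> = "m / (2 * K)" and C = "K\<^sup>2 * R"])
    have "linear (\<lambda>v. - (LINT x|lborel. \<phi> x * form mon v x * exp (- form mon c x)))"
    proof (rule linearI)
      show "- (LINT x|lborel. \<phi> x * form mon (v + w) x * exp (- form mon c x)) =
        - (LINT x|lborel. \<phi> x * form mon v x * exp (- form mon c x)) +
        - (LINT x|lborel. \<phi> x * form mon w x * exp (- form mon c x))" for v w
        using int1[of v] int1[of w] by (simp add: form_add distrib_left distrib_right)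
      show "- (LINT x|lborel. \<phi> x * form mon (a *\<^sub>R v) x * exp (- form mon c x)) =
        a *\<^sub>R - (LINT x|lborel. \<phi> x * form mon v x * exp (- form mon c x))" for a v
      proof -
        have "(\<lambda>x. \<phi> x * form mon (a *\<^sub>R v) x * exp (- form mon c x)) =
          (\<lambda>x. a * (\<phi> x * form mon v x * exp (- form mon c x)))"
          by (simp add: form_scale mult_ac)
        then show ?thesis by simp
      qed
    qed
    then show "bounded_linear (\<lambda>v. - (LINT x|lborel. \<phi> x * form mon v x * exp (- form mon c x)))"
      by (simp add: linear_conv_bounded_linear)
  next
    show "m / (2 * K) > 0" using m K by simp
  next
    fix v :: "real^'m" assume v: "norm v \<le> m / (2 * K)"
    have small: "\<bar>form mon v x\<bar> \<le> (m / 2) * N x" for x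
    proof -
      have "K * norm v \<le> m / 2" using v K(1) by (simp add: field_simps)
      then show ?thesis
        using K(2)[of v x] N(2)[of x] mult_right_mono order_trans by blast
    qed
    \<comment> \<open>The perturbed form keeps at least half of the lower bound, so it stays in the
      cone and its exponential integral converges.\<close>
    have "form mon (c + v) \<in> phf_cone (real k)"
    proof (intro phf_coneI phf_form[OF mon])
      fix x :: "real^'n" assume "x \<noteq> 0"
      then have "(m / 2) * N x > 0" using m N(3) by simp
      then show "form mon (c + v) x > 0"
        using m(2)[of x] small[of x] unfolding form_add by linarith
    qed (use k in auto)
    then have intv: "integrable lborel (\<lambda>x. \<phi> x * exp (- form mon (c + v) x))"
      using laplace_sublevel(1)[OF \<phi>] k by simp
    define D where "D = (\<lambda>x. \<phi> x * exp (- form mon (c + v) x) - \<phi> x * exp (- form mon c x)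
      + \<phi> x * form mon v x * exp (- form mon c x))"
    have D_eq: "D x = \<phi> x * exp (- form mon c x) * (exp (- form mon v x) - 1 + form mon v x)" for x
    proof -
      have "exp (- form mon (c + v) x) = exp (- form mon c x) * exp (- form mon v x)"
        by (simp add: form_add mult_exp_exp)
      then show ?thesis by (simp add: D_def algebra_simps)
    qed
    have "\<bar>D x\<bar> \<le> (K * norm v)\<^sup>2 * (\<bar>\<phi> x\<bar> * (N x * N x) * exp (- g x))" for x
    proof -
      have "\<bar>D x\<bar> \<le> \<bar>\<phi> x\<bar> * exp (- form mon c x) * ((form mon v x)\<^sup>2 * exp \<bar>form mon v x\<bar>)"
        unfolding D_eq abs_mult abs_exp_cancel
        by (intro mult_left_mono exp_quadratic_remainder) auto
      also have "\<dots> = \<bar>\<phi> x\<bar> * (form mon v x)\<^sup>2 * exp (- form mon c x + \<bar>form mon v x\<bar>)"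
        by (simp only: exp_add mult_ac)
      also have "\<dots> \<le> \<bar>\<phi> x\<bar> * (K * norm v * N x)\<^sup>2 * exp (- g x)"
      proof (intro mult_mono mult_nonneg_nonneg)
        show "(form mon v x)\<^sup>2 \<le> (K * norm v * N x)\<^sup>2"
          using power_mono[OF K(2)[of v x], of 2] by simp
        show "exp (- form mon c x + \<bar>form mon v x\<bar>) \<le> exp (- g x)"
          using m(2)[of x] small[of x] by (simp add: g_def)
      qed auto
      also have "\<dots> = (K * norm v)\<^sup>2 * (\<bar>\<phi> x\<bar> * (N x * N x) * exp (- g x))"
        by (simp add: power2_eq_square mult_ac)
      finally show ?thesis .
    qed
    moreover have intD: "integrable lborel D"
      unfolding D_def using int0 int1 intv by (intro Bochner_Integration.integrable_add Bochner_Integration.integrable_diff)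
    ultimately have "\<bar>integral\<^sup>L lborel D\<bar> \<le>
        (LINT x|lborel. (K * norm v)\<^sup>2 * (\<bar>\<phi> x\<bar> * (N x * N x) * exp (- g x)))"
      using intR by (intro order_trans[OF integral_abs_bound] integral_mono) auto
    also have "\<dots> = K\<^sup>2 * R * (norm v)\<^sup>2"
      by (simp add: R_def power_mult_distrib)
    also have "integral\<^sup>L lborel D = (LINT x|lborel. \<phi> x * exp (- form mon (c + v) x)) -
        (LINT x|lborel. \<phi> x * exp (- form mon c x)) -
        - (LINT x|lborel. \<phi> x * form mon v x * exp (- form mon c x))"
      unfolding D_def using int0 int1[of v] intv by simp
    finally show "\<bar>(LINT x|lborel. \<phi> x * exp (- form mon (c + v) x)) -
        (LINT x|lborel. \<phi> x * exp (- form mon c x)) -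
        - (LINT x|lborel. \<phi> x * form mon v x * exp (- form mon c x))\<bar> \<le> K\<^sup>2 * R * (norm v)\<^sup>2" .
  qed
qed

section \<open>Gradient, Hessian and moments on the interior of the cone of forms\<close>

context
  fixes h :: "real^'n \<Rightarrow> real" and p :: real and k :: nat and mon :: "'m::finite \<Rightarrow> nat^'n"
  assumes h: "phf p h" and mon: "enumerates_degree k mon" and k: "k \<noteq> 0"
begin

private lemma cone: "c \<in> interior (form_cone mon) \<Longrightarrow> form mon c \<in> phf_cone (real k)"
  using interior_subset form_cone_iff_phf_cone[OF mon] by blast

private lemma k': "real k \<noteq> 0"
  using k by simp

lemma mono_mult_integrable:
  assumes "c \<in> interior (form_cone mon)"
  shows "integrable lborel (\<lambda>x. mono_eval (mon i) x * h x * exp (- form mon c x))"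
    and "integrable lborel (\<lambda>x. mono_eval (mon i + mon j) x * h x * exp (- form mon c x))"
    and "set_integrable lborel (sublevel (form mon c)) (\<lambda>x. mono_eval (mon i) x * h x)"
  using laplace_sublevel(1)[OF phf_mult[OF phf_mono_eval[of "mon i"] h] cone[OF assms] k']
    laplace_sublevel(1)[OF phf_mult[OF phf_mono_eval[of "mon i + mon j"] h] cone[OF assms] k']
    set_integrable_sublevel[OF cone[OF assms] phf_continuous_on[OF phf_mult[OF phf_mono_eval[of "mon i"] h]]]
  by simp_all

text \<open>Stated for any \<open>F\<close> agreeing with a scaled exponential integral on the open
  interior, so that it can be iterated: a partial derivative of \<open>F\<close> is known by such a
  formula there, with \<open>\<phi>\<close> replaced by a monomial times
  \<open>\<phi>\<close>.\<close>

lemma exp_integral_partial_deriv: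
  fixes \<phi> :: "real^'n \<Rightarrow> real"
  assumes \<phi>: "phf r \<phi>" and c: "c \<in> interior (form_cone mon)"
    and F: "\<And>c. c \<in> interior (form_cone mon) \<Longrightarrow>
      F c = a * (LINT x|lborel. \<phi> x * exp (- form mon c x))"
  shows "F differentiable (at c)"
    and "partial_deriv i F c = - a * (LINT x|lborel. mono_eval (mon i) x * \<phi> x * exp (- form mon c x))"
proof -
  have "((\<lambda>c. a * (LINT x|lborel. \<phi> x * exp (- form mon c x))) has_derivative
    (\<lambda>v. a * - (LINT x|lborel. \<phi> x * form mon v x * exp (- form mon c x)))) (at c)"
    using c interior_subset
    by (intro has_derivative_mult_right exp_integral_has_derivative[OF \<phi> mon k]) blast
  then have deriv: "(F has_derivative
    (\<lambda>v. a * - (LINT x|lborel. \<phi> x * form mon v x * exp (- form mon c x)))) (at c)"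
    by (rule has_derivative_transform_within_open[OF _ open_interior c]) (simp add: F)
  then show "F differentiable (at c)"
    unfolding differentiable_def by blast
  show "partial_deriv i F c = - a * (LINT x|lborel. mono_eval (mon i) x * \<phi> x * exp (- form mon c x))"
    unfolding partial_deriv_has_derivative[OF deriv] form_axis by (simp add: mult_ac)
qed

lemma sublevel_integral_form_derivatives:
  defines "f \<equiv> \<lambda>c. sublevel_integral h (form mon c)" and "q \<equiv> (real CARD('n) + p) / real k"
  assumes c: "c \<in> interior (form_cone mon)"
  shows "f differentiable (at c)"
    and "gradient f differentiable (at c)"
    and "partial_deriv i f c = - 1 / Gamma (1 + q) *
      (LINT x|lborel. mono_eval (mon i) x * h x * exp (- form mon c x))"
    and "partial_deriv i f c = - Gamma (2 + q) / Gamma (1 + q) *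
      (LINT x:sublevel (form mon c)|lborel. mono_eval (mon i) x * h x)"
    and "partial_deriv i (partial_deriv j f) c = 1 / Gamma (1 + q) *
      (LINT x|lborel. mono_eval (mon i + mon j) x * h x * exp (- form mon c x))"
proof -
  have f: "f c = 1 / Gamma (1 + q) * (LINT x|lborel. h x * exp (- form mon c x))"
    if "c \<in> interior (form_cone mon)" for c
    unfolding f_def q_def by (rule laplace_sublevel(3)[OF h cone[OF that] k'])
  show "f differentiable (at c)"
    by (rule exp_integral_partial_deriv(1)[OF h c f])
  have first: "partial_deriv i f c = - (1 / Gamma (1 + q)) *
      (LINT x|lborel. mono_eval (mon i) x * h x * exp (- form mon c x))"
    if "c \<in> interior (form_cone mon)" for c i
    by (rule exp_integral_partial_deriv(2)[OF h that f])
  then show eq1: "partial_deriv i f c = - 1 / Gamma (1 + q) *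
      (LINT x|lborel. mono_eval (mon i) x * h x * exp (- form mon c x))"
    using c by simp
  note phf_mono_h = phf_mult[OF phf_mono_eval_enumerated[OF mon] h]
  \<comment> \<open>Multiplying \<open>h\<close> by a monomial raises the degree by
    \<open>k\<close>, which shifts the argument of \<open>Gamma\<close> by exactly one.\<close>
  have "1 + (real CARD('n) + (real k + p)) / real k = 2 + q"
    using k by (simp add: q_def field_simps)
  then have "(LINT x|lborel. mono_eval (mon i) x * h x * exp (- form mon c x)) =
    Gamma (2 + q) * (LINT x:sublevel (form mon c)|lborel. mono_eval (mon i) x * h x)"
    using laplace_sublevel(2)[OF phf_mono_h cone[OF c] k', of i] by (simp add: sublevel_integral_def)
  then show "partial_deriv i f c = - Gamma (2 + q) / Gamma (1 + q) *
      (LINT x:sublevel (form mon c)|lborel. mono_eval (mon i) x * h x)"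
    unfolding eq1 by simp
  show "gradient f differentiable (at c)"
    by (intro gradient_differentiable exp_integral_partial_deriv(1)[OF phf_mono_h c first])
  \<comment> \<open>Second use of the differentiation lemma, now for
    \<open>partial_deriv j f\<close> with scalar \<open>- (1 / Gamma (1 + q))\<close>; the two minus
    signs cancel.\<close>
  have "partial_deriv i (partial_deriv j f) c = - (- (1 / Gamma (1 + q))) *
      (LINT x|lborel. mono_eval (mon i) x * (mono_eval (mon j) x * h x) * exp (- form mon c x))"
    by (rule exp_integral_partial_deriv(2)[OF phf_mono_h c first])
  then show "partial_deriv i (partial_deriv j f) c = 1 / Gamma (1 + q) *
      (LINT x|lborel. mono_eval (mon i + mon j) x * h x * exp (- form mon c x))"
    by (simp add: mono_eval_add mult.assoc)
qed

lemma sublevel_integral_form_strictly_convex: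
  assumes "h x0 \<noteq> 0" and nonneg: "\<And>x. 0 \<le> h x"
  shows "strictly_convex_on (interior (form_cone mon)) (\<lambda>c. sublevel_integral h (form mon c))"
  unfolding strictly_convex_on_def
proof (intro conjI ballI allI impI)
  show "convex (interior (form_cone mon))"
    by (intro convex_interior convex_form_cone[OF mon k])
  fix c1 c2 :: "real^'m" and u v :: real
  assume c: "c1 \<in> interior (form_cone mon)" "c2 \<in> interior (form_cone mon)"
    and uv: "0 < u" "0 < v" and ne: "c1 \<noteq> c2 \<and> u + v = 1"
  \<comment> \<open>Otherwise the form with coefficients \<open>c1 - c2\<close> would vanish on the
    nonempty open set where \<open>h\<close> is positive, forcing \<open>c1 = c2\<close>.\<close>
  have "\<exists>x. h x > 0 \<and> form mon c1 x \<noteq> form mon c2 x"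
  proof (rule ccontr)
    assume "\<not> ?thesis"
    then have "form mon (c1 - c2) x = 0" if "x \<in> {x. 0 < h x}" for x
      using that form_add[of mon "c1 - c2" c2 x] by auto
    moreover have "open {x. 0 < h x}"
      by (intro open_Collect_less continuous_on_const phf_continuous_on[OF h])
    moreover have "x0 \<in> {x. 0 < h x}"
      using assms(1) nonneg[of x0] by simp
    moreover have "inj mon"
      using mon by (simp add: enumerates_degree_def bij_betw_def)
    ultimately have "c1 - c2 = 0"
      using form_eq_zero_on_open_imp_zero by blast
    then show False using ne by simp
  qed
  then obtain x where x: "h x > 0" "form mon c1 x \<noteq> form mon c2 x" by blast
  have "form mon (u *\<^sub>R c1 + v *\<^sub>R c2) = (\<lambda>x. u * form mon c1 x + v * form mon c2 x)"
    by (simp add: fun_eq_iff form_add form_scale)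
  then show "sublevel_integral h (form mon (u *\<^sub>R c1 + v *\<^sub>R c2)) <
      u * sublevel_integral h (form mon c1) + v * sublevel_integral h (form mon c2)"
    using sublevel_integral_convex(2)[OF h nonneg k' cone[OF c(1)] cone[OF c(2)] _ _ _ uv x] uv ne
    by simp
qed

text \<open>A nontrivial \<open>h\<close> has nonnegative degree, so the \<open>Gamma\<close> factor
  is positive and the density nonnegative. Hence \<open>ennreal\<close> truncates nothing, and
  integrals against the measure are weighted Lebesgue integrals.\<close>

lemma exp_measure_moment:
  assumes "h x0 \<noteq> 0" and nonneg: "\<And>x. 0 \<le> h x" and c: "c \<in> interior (form_cone mon)"
  shows "integrable (exp_measure h p (real k) (form mon c)) (mono_eval (mon i + mon j))"
    and "(LINT x|exp_measure h p (real k) (form mon c). mono_eval (mon i + mon j) x) =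
      1 / Gamma (1 + (real CARD('n) + p) / real k) *
      (LINT x|lborel. mono_eval (mon i + mon j) x * h x * exp (- form mon c x))"
proof -
  define G where "G = 1 / Gamma (1 + (real CARD('n) + p) / real k)"
  have "G > 0"
    unfolding G_def using phf_degree_nonneg[OF h assms(1)] k
    by (intro divide_pos_pos Gamma_real_pos add_pos_nonneg) auto
  then have nn: "AE x in lborel. 0 \<le> G * (h x * exp (- form mon c x))"
    using nonneg by simp
  have meas: "mono_eval (mon i + mon j) \<in> borel_measurable lborel"
      "(\<lambda>x. G * (h x * exp (- form mon c x))) \<in> borel_measurable lborel"
    using phf_continuous_on[OF h] phf_continuous_on[OF phf_form[OF mon]]
    by (auto intro!: borel_measurable_continuous_onI continuous_intros)
  have eq: "(\<lambda>x. (G * (h x * exp (- form mon c x))) *\<^sub>R mono_eval (mon i + mon j) x) =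
      (\<lambda>x. G * (mono_eval (mon i + mon j) x * h x * exp (- form mon c x)))"
    by (simp add: mult_ac)
  show "integrable (exp_measure h p (real k) (form mon c)) (mono_eval (mon i + mon j))"
    unfolding exp_measure_def G_def[symmetric] integrable_density[OF meas nn] eq
    using mono_mult_integrable(2)[OF c] by simp
  show "(LINT x|exp_measure h p (real k) (form mon c). mono_eval (mon i + mon j) x) =
      1 / Gamma (1 + (real CARD('n) + p) / real k) *
      (LINT x|lborel. mono_eval (mon i + mon j) x * h x * exp (- form mon c x))"
    unfolding exp_measure_def G_def[symmetric] integral_density[OF meas nn] eq by simp
qed

end

theorem corollary2p5:
  fixes h :: "real^'n \<Rightarrow> real" and p d :: real
    and mon :: "'m::finite \<Rightarrow> nat^'n"
  assumes "phf p h" and "d \<noteq> 0"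
  shows
    "((\<forall>g\<in>phf_cone d. set_integrable lborel (sublevel g) h) \<and>
      homogeneous_functional_on (phf_cone d) (- (real CARD('n) + p) / d) (sublevel_integral h) \<and>
      ((\<forall>x. 0 \<le> h x) \<longrightarrow> convex_functional_on (phf_cone d) (sublevel_integral h)) \<and>
      ((\<forall>x. x \<noteq> 0 \<longrightarrow> 0 < h x) \<longrightarrow>
         strictly_convex_functional_on (phf_cone d) (sublevel_integral h)))
     \<and>
     (\<forall>k::nat. d = real k \<and> enumerates_degree k mon \<and> continuous_on UNIV h \<and>
        (\<forall>c\<in>interior (form_cone mon).
           integrable lborel (\<lambda>x. \<bar>h x\<bar> * exp (- form mon c x))) \<longrightarrow>
        (let f = (\<lambda>c. sublevel_integral h (form mon c));
             P = interior (form_cone mon);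
             q = (real CARD('n) + p) / d
         in
          (twice_differentiable_on_open f P \<and>
           (\<forall>c\<in>P. \<forall>i.
              integrable lborel (\<lambda>x. mono_eval (mon i) x * h x * exp (- form mon c x)) \<and>
              set_integrable lborel (sublevel (form mon c)) (\<lambda>x. mono_eval (mon i) x * h x) \<and>
              partial_deriv i f c =
                - 1 / Gamma (1 + q) *
                  (LINT x|lborel. mono_eval (mon i) x * h x * exp (- form mon c x)) \<and>
              partial_deriv i f c =
                - Gamma (2 + q) / Gamma (1 + q) *
                  (LINT x:sublevel (form mon c)|lborel. mono_eval (mon i) x * h x)) \<and>
           (\<forall>c\<in>P. \<forall>i j.
              integrable lborel (\<lambda>x. mono_eval (mon i + mon j) x * h x * exp (- form mon c x)) \<and>
              partial_deriv i (partial_deriv j f) c =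
                1 / Gamma (1 + q) *
                  (LINT x|lborel. mono_eval (mon i + mon j) x * h x * exp (- form mon c x))))
          \<and>
          ((\<exists>x. h x \<noteq> 0) \<and> (\<forall>x. 0 \<le> h x) \<longrightarrow>
             strictly_convex_on P f \<and>
             (\<forall>c\<in>P.
                (\<forall>i j. integrable (exp_measure h p d (form mon c)) (mono_eval (mon i + mon j))) \<and>
                hessian f c =
                  (\<chi> i j. LINT x|exp_measure h p d (form mon c). mono_eval (mon i + mon j) x)))))"
proof (intro conjI allI impI, goal_cases)
  case 1
  then show ?case
    using set_integrable_sublevel phf_continuous_on[OF assms(1)] by blast
next
  case 2
  then show ?case by (rule sublevel_integral_homogeneous_on_phf_cone[OF assms])
next
  case 3
  then show ?case by (intro sublevel_integral_convex_on_phf_cone[OF assms]) blast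
next
  case 4
  then show ?case by (intro sublevel_integral_strictly_convex_on_phf_cone[OF assms(1) _ assms(2)]) blast
next
  case (5 k)
  \<comment> \<open>The hypothesis \<open>d \<noteq> 0\<close> excludes degree 0, as the results on
    forms require.\<close>
  then have d: "d = real k" and mon: "enumerates_degree k mon" and k: "k \<noteq> 0"
    using assms(2) by auto
  note derivs = sublevel_integral_form_derivatives[OF assms(1) mon k]
    and ints = mono_mult_integrable[OF assms(1) mon k]
  have b: "strictly_convex_on (interior (form_cone mon)) (\<lambda>c. sublevel_integral h (form mon c)) \<and>
      (\<forall>c\<in>interior (form_cone mon).
        (\<forall>i j. integrable (exp_measure h p (real k) (form mon c)) (mono_eval (mon i + mon j))) \<and>
        hessian (\<lambda>c. sublevel_integral h (form mon c)) c =
          (\<chi> i j. LINT x|exp_measure h p (real k) (form mon c). mono_eval (mon i + mon j) x))"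
    if h: "(\<exists>x. h x \<noteq> 0) \<and> (\<forall>x. 0 \<le> h x)"
  proof -
    obtain x0 where x0: "h x0 \<noteq> 0" using h by blast
    have nonneg: "\<And>x. 0 \<le> h x" using h by blast
    note moments = exp_measure_moment[OF assms(1) mon k x0 nonneg]
    show ?thesis
      using sublevel_integral_form_strictly_convex[OF assms(1) mon k x0 nonneg]
        moments derivs(5) by (simp add: hessian_def)
  qed
  show ?case
    unfolding Let_def d twice_differentiable_on_open_def
    by (intro conjI ballI allI impI) (erule derivs ints | drule b, blast)+
qed

end
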